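(* Let $F:\mathbb{R}^n\to\mathbb{R}\cup\{+\infty\}$ be proper closed convex with minimum value $F^*$, let $\gamma>0$, and let $F_\gamma$ be a smooth approximation of $F$ satisfying the Smoothing Assumption (A.1–A.4 in the context) with operator $\mathcal{B}$ and constant $D\ge0$. Let $x_*$ be a minimizer of $F_\gamma$ over $\mathbb{R}^n$, let $\alpha\in\mathbb{R}$, $\beta=\alpha/2$, and let $(x_k)_{k\ge0}$ be generated by Algorithm 2 (in the context). Then for $k\ge1$ $$\mathbb{E}[F(\mathcal{B}(x_k))]-F^*\ \le\ \frac{2S_\beta^2(\gamma)\|x_0-x_*\|_{1-\alpha}^2}{k^2}+\gamma D.$$
   Context: Blocks: $U=[U_1,\dots,U_N]$ is a column permutation of the $n\times n$ identity matrix, $U_i\in\mathbb{R}^{n\times n_i}$, $\sum_in_i=n$, $x^{(i)}=U_i^Tx$. On each $\mathbb{R}^{n_i}$ some norm $\|\cdot\|_{(i)}$ is fixed. Smoothing Assumption: A.1: $F_\gamma^*=\min_xF_\gamma(x)$ satisfies $F_\gamma^*\le F^*$. A.2: there are operators $\mathcal{B},\mathcal{C}$ and a constant $D\ge0$ with $F(\mathcal{B}(x))-\gamma D\le F_\gamma(x)\le F(\mathcal{C}(x))$ for all $x\in\mathrm{dom}\,F$. A.3: the gradient of $F_\gamma$ is block coordinate-wise Lipschitz continuous on $\mathbb{R}^n$ with constants $L_i(F_\gamma)>0$: $\|U_i^T(\nabla F_\gamma(x+U_ih)-\nabla F_\gamma(x))\|_{(i)}\le L_i(F_\gamma)\|h\|_{(i)}$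 for all $x\in\mathbb{R}^n$, $h\in\mathbb{R}^{n_i}$, $i=1,\dots,N$. A.4: $F_\gamma$ is convex. Notation: for a real exponent $t$, $S_t=S_t(\gamma)=\sum_{i=1}^NL_i(F_\gamma)^t$ and $\|x\|_t^2=\sum_{i=1}^NL_i(F_\gamma)^t\|x^{(i)}\|_{(i)}^2$; $\pi_\beta[i]=L_i(F_\gamma)^\beta/S_\beta$. $\sigma_{1-\alpha}\ge0$ is the strong convexity parameter of $F_\gamma$ with respect to the norm $\|\cdot\|_{1-\alpha}$. Algorithm 2: $\nu_0=x_0\in\mathrm{dom}\,F_\gamma$, $A_0=0$, $B_0=1$, $\beta=\alpha/2$. For $k\ge0$: 1. sample $i_k\in\{1,\dots,N\}$ with probabilities $\mathbb{P}[i_k=i]=L_i(F_\gamma)^\alpha/S_\alpha(\gamma)$; 2. find $a_{k+1}>0$ with $a_{k+1}^2S_\beta^2=A_{k+1}B_{k+1}$, where $A_{k+1}=A_k+a_{k+1}$, $B_{k+1}=B_k+\sigma_{1-\alpha}a_{k+1}$; 3. set $\alpha_k=\frac{a_{k+1}}{A_{k+1}}$, $\beta_k=\frac{\sigma_{1-\alpha}a_{k+1}}{B_{k+1}}$, $y_k=\frac{(1-\alpha_k)x_k+\alpha_k(1-\beta_k)\nu_k}{1-\alpha_k\beta_k}$; 4. compute $h_k=-U_{i_k}^T\nabla F_\gamma(y_k)$; 5. set $x_{k+1}=y_k+\frac{1}{L_{i_k}(F_\gamma)}U_{i_k}h_k$ and $\nu_{k+1}=(1-\beta_k)\nu_k+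\beta_ky_k+\frac{a_{k+1}}{L_{i_k}(F_\gamma)^{1-\alpha}B_{k+1}\pi_\beta[i_k]}U_{i_k}h_k$.
   Formalization: Blocks are sampled with probabilities π_β[i]=L_i^β/S_β, β=α/2, instead of L_i^α/S_α; the block norms are assumed to satisfy ‖h‖_2 ≤ ‖h‖_(i); and the inequalities of A.2 are assumed to hold at x_k almost surely, since x_k need not lie in dom F. *)

theory Defs
  imports "HOL-Probability.Probability"
begin

(* Extended-real valued convex functions *)

definition edom :: "('a \<Rightarrow> ereal) \<Rightarrow> 'a set" where
  "edom F = {x. F x < \<infinity>}"

definition ereal_epigraph :: "('a \<Rightarrow> ereal) \<Rightarrow> ('a \<times> real) set" where
  "ereal_epigraph F = {(x, r). F x \<le> ereal r}"

definition proper_closed_convex :: "('a::euclidean_space \<Rightarrow> ereal) \<Rightarrow> bool" where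
  "proper_closed_convex F \<longleftrightarrow>
     (\<forall>x. F x \<noteq> -\<infinity>) \<and> edom F \<noteq> {} \<and>
     closed (ereal_epigraph F) \<and> convex (ereal_epigraph F)"

(* The usual E[X] = E[X^+] - E[X^-]; the coercion e2ennreal truncates negative values to 0. *)
definition ereal_expectation :: "'w measure \<Rightarrow> ('w \<Rightarrow> ereal) \<Rightarrow> ereal" where
  "ereal_expectation M X =
     enn2ereal (\<integral>\<^sup>+ w. e2ennreal (X w) \<partial>M) - enn2ereal (\<integral>\<^sup>+ w. e2ennreal (- X w) \<partial>M)"

(* Blocks.  The decomposition U = [U_1, ..., U_N] of a column permutation of the identity is
   a partition of the coordinates, given by the map blk that sends a coordinate to its block.
   R^(n_i) is identified through U_i with its range, the subspace block_space blk i;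
   under this identification U_i^T x becomes U_i U_i^T x, that is, block_part blk i x. *)

definition block_space :: "('n \<Rightarrow> 'b) \<Rightarrow> 'b \<Rightarrow> (real^'n) set" where
  "block_space blk i = {h. \<forall>j. blk j \<noteq> i \<longrightarrow> h $ j = 0}"

definition block_part :: "('n \<Rightarrow> 'b) \<Rightarrow> 'b \<Rightarrow> real^'n \<Rightarrow> real^'n" where
  "block_part blk i x = (\<chi> j. if blk j = i then x $ j else 0)"

definition is_norm_on :: "'a::real_vector set \<Rightarrow> ('a \<Rightarrow> real) \<Rightarrow> bool" where
  "is_norm_on V p \<longleftrightarrow>
     (\<forall>x\<in>V. 0 \<le> p x \<and> (p x = 0 \<longleftrightarrow> x = 0)) \<and>
     (\<forall>x\<in>V. \<forall>c. p (c *\<^sub>R x) = \<bar>c\<bar> * p x) \<and>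
     (\<forall>x\<in>V. \<forall>y\<in>V. p (x + y) \<le> p x + p y)"

(* S_t *)
definition Lsum :: "('b::finite \<Rightarrow> real) \<Rightarrow> real \<Rightarrow> real" where
  "Lsum L t = (\<Sum>i\<in>UNIV. L i powr t)"

(* pi_t[i] *)
definition Lprob :: "('b::finite \<Rightarrow> real) \<Rightarrow> real \<Rightarrow> 'b \<Rightarrow> real" where
  "Lprob L t i = L i powr t / Lsum L t"

definition wnorm :: "('n \<Rightarrow> 'b::finite) \<Rightarrow> ('b \<Rightarrow> real^'n \<Rightarrow> real) \<Rightarrow> ('b \<Rightarrow> real) \<Rightarrow> real
    \<Rightarrow> real^'n \<Rightarrow> real" where
  "wnorm blk nrm L t x = sqrt (\<Sum>i\<in>UNIV. L i powr t * (nrm i (block_part blk i x))\<^sup>2)"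

(* Strong convexity of a differentiable f with gradient g, with modulus \<sigma>
   with respect to the norm p *)
definition strongly_convex :: "('a::real_inner \<Rightarrow> real) \<Rightarrow> ('a \<Rightarrow> 'a) \<Rightarrow> ('a \<Rightarrow> real) \<Rightarrow> real \<Rightarrow> bool"
  where
  "strongly_convex f g p \<sigma> \<longleftrightarrow>
     0 \<le> \<sigma> \<and> (\<forall>x y. f y \<ge> f x + g x \<bullet> (y - x) + \<sigma> / 2 * (p (y - x))\<^sup>2)"

(* Smoothing.  Fg is the smooth approximation of F, g its gradient, Bop and Cop the operators. *)

definition smoothing_bounds :: "('a \<Rightarrow> ereal) \<Rightarrow> ('a \<Rightarrow> real) \<Rightarrow> ('a \<Rightarrow> 'a) \<Rightarrow> ('a \<Rightarrow> 'a)
    \<Rightarrow> real \<Rightarrow> real \<Rightarrow> 'a \<Rightarrow> bool" where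
  "smoothing_bounds F Fg Bop Cop \<gamma> D x \<longleftrightarrow>
     F (Bop x) - ereal (\<gamma> * D) \<le> ereal (Fg x) \<and> ereal (Fg x) \<le> F (Cop x)"

definition block_lipschitz :: "('n \<Rightarrow> 'b) \<Rightarrow> ('b \<Rightarrow> real^'n \<Rightarrow> real) \<Rightarrow> ('b \<Rightarrow> real)
    \<Rightarrow> (real^'n \<Rightarrow> real^'n) \<Rightarrow> bool" where
  "block_lipschitz blk nrm L g \<longleftrightarrow>
     (\<forall>i. 0 < L i) \<and>
     (\<forall>i x. \<forall>h\<in>block_space blk i.
        nrm i (block_part blk i (g (x + h) - g x)) \<le> L i * nrm i h)"

definition smoothing_assumption :: "(real^'n \<Rightarrow> ereal) \<Rightarrow> real \<Rightarrow> (real^'n \<Rightarrow> real)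
    \<Rightarrow> (real^'n \<Rightarrow> real^'n) \<Rightarrow> (real^'n \<Rightarrow> real^'n) \<Rightarrow> (real^'n \<Rightarrow> real^'n) \<Rightarrow> real \<Rightarrow> real
    \<Rightarrow> ('n \<Rightarrow> 'b) \<Rightarrow> ('b \<Rightarrow> real^'n \<Rightarrow> real) \<Rightarrow> ('b \<Rightarrow> real) \<Rightarrow> bool" where
  "smoothing_assumption F Fstar Fg g Bop Cop \<gamma> D blk nrm L \<longleftrightarrow>
     (\<exists>z. (\<forall>y. Fg z \<le> Fg y) \<and> Fg z \<le> Fstar) \<and>
     0 \<le> D \<and> (\<forall>x\<in>edom F. smoothing_bounds F Fg Bop Cop \<gamma> D x) \<and>
     (\<forall>x. GDERIV Fg x :> g x) \<and> block_lipschitz blk nrm L g \<and>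
     convex_on UNIV Fg"

(* Accelerated coordinate descent with \<beta> = \<alpha>/2.  The scalar sequences are deterministic. *)

definition acd_scalars :: "('b::finite \<Rightarrow> real) \<Rightarrow> real \<Rightarrow> real
    \<Rightarrow> (nat \<Rightarrow> real) \<Rightarrow> (nat \<Rightarrow> real) \<Rightarrow> (nat \<Rightarrow> real) \<Rightarrow> bool" where
  "acd_scalars L \<alpha> \<sigma> a A B \<longleftrightarrow>
     A 0 = 0 \<and> B 0 = 1 \<and>
     (\<forall>k. 0 < a (Suc k) \<and>
          A (Suc k) = A k + a (Suc k) \<and>
          B (Suc k) = B k + \<sigma> * a (Suc k) \<and>
          (a (Suc k))\<^sup>2 * (Lsum L (\<alpha> / 2))\<^sup>2 = A (Suc k) * B (Suc k))"

(* One sample path, driven by the block choices I 0, I 1, ... *)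
definition acd_path :: "('n \<Rightarrow> 'b::finite) \<Rightarrow> ('b \<Rightarrow> real) \<Rightarrow> (real^'n \<Rightarrow> real^'n) \<Rightarrow> real \<Rightarrow> real
    \<Rightarrow> (nat \<Rightarrow> real) \<Rightarrow> (nat \<Rightarrow> real) \<Rightarrow> (nat \<Rightarrow> real) \<Rightarrow> real^'n
    \<Rightarrow> (nat \<Rightarrow> 'b) \<Rightarrow> (nat \<Rightarrow> real^'n) \<Rightarrow> (nat \<Rightarrow> real^'n) \<Rightarrow> (nat \<Rightarrow> real^'n) \<Rightarrow> bool" where
  "acd_path blk L g \<alpha> \<sigma> a A B x0 I x y \<nu> \<longleftrightarrow>
     x 0 = x0 \<and> \<nu> 0 = x0 \<and>
     (\<forall>k. let \<alpha>k = a (Suc k) / A (Suc k);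
              \<beta>k = \<sigma> * a (Suc k) / B (Suc k);
              i = I k;
              h = - block_part blk i (g (y k))
          in y k = (1 / (1 - \<alpha>k * \<beta>k)) *\<^sub>R
                     ((1 - \<alpha>k) *\<^sub>R x k + (\<alpha>k * (1 - \<beta>k)) *\<^sub>R \<nu> k) \<and>
             x (Suc k) = y k + (1 / L i) *\<^sub>R h \<and>
             \<nu> (Suc k) = (1 - \<beta>k) *\<^sub>R \<nu> k + \<beta>k *\<^sub>R y k +
               (a (Suc k) / (L i powr (1 - \<alpha>) * B (Suc k) * Lprob L (\<alpha> / 2) i)) *\<^sub>R h)"

(* Independent draws with law pi_\<beta>, \<beta> = \<alpha>/2.  This is the law whose inverse weights the
   \<nu>-step in acd_path; with any other law that step is a biased gradient estimate.
   (With weights L_i^\<alpha> / S_\<alpha> the 1/k^2 estimate fails already for a quadratic in the plane.) *)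
definition acd_sampling :: "'w measure \<Rightarrow> ('b::finite \<Rightarrow> real) \<Rightarrow> real \<Rightarrow> (nat \<Rightarrow> 'w \<Rightarrow> 'b) \<Rightarrow> bool" where
  "acd_sampling M L \<alpha> I \<longleftrightarrow>
     prob_space.indep_vars M (\<lambda>_. count_space UNIV) I UNIV \<and>
     (\<forall>k i. measure M {w \<in> space M. I k w = i} = Lprob L (\<alpha> / 2) i)"

end

theory Submission
  imports Defs
begin

text \<open>
The proof is a potential argument.  Let \<open>S = Lsum L (\<alpha> / 2)\<close> and let \<open>Q\<close> be the square of the weighted
norm with exponent \<open>1 - \<alpha>\<close>, taken with the Euclidean norm on every block.  In expectation, the potential

  \<open>2 * A k * (Fg (x k) - Fg xstar) + B k * Q (\<nu> k - xstar)\<close>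

does not increase (\<open>acd_step_potential\<close>).  It starts at \<open>Q (x0 - xstar)\<close>, and the
equation for \<open>a\<close> forces \<open>A k \<ge> k\<^sup>2 / (4 * S\<^sup>2)\<close> (\<open>acd_scalars_growth\<close>), which gives the rate for the
smooth approximation \<open>Fg\<close>.  The bounds \<open>F (Bop x) \<le> Fg x + \<gamma> * D\<close> at the iterate and
\<open>Fg xstar \<le> Fstar\<close> transfer it to \<open>F\<close>.

The subtle point is that the block norms are arbitrary, while the algorithm steps along the Euclidean
gradient and the potential needs an inner product norm.  It is settled by
\<open>lipschitz_gradient_norm_independent\<close>: if the gradient of a convex function is \<open>L\<close>-Lipschitz with one
and the same norm used for points and gradients, then the Euclidean curvature is at most \<open>L\<close>, just as the
spectral radius of a symmetric matrix is at most any of its operator norms.  Hence the constants \<open>L i\<close>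
are valid for Euclidean block steps (\<open>block_gradient_step\<close>).  As the block norms dominate the Euclidean
norm, the strong convexity hypothesis and the distance in the final bound are both monotone in the
direction that the reduction to the Euclidean case requires.

The draws take values in a finite type, so expectations are finite sums over histories, and the
averaged decrease in one step iterates (\<open>expectation_potential_le\<close>).
\<close>

section \<open>Smooth convex functions and the choice of norm\<close>

lemma is_norm_onD:
  assumes "is_norm_on V p"
  shows "v \<in> V \<Longrightarrow> 0 \<le> p v" "v \<in> V \<Longrightarrow> p (c *\<^sub>R v) = \<bar>c\<bar> * p v"
    "u \<in> V \<Longrightarrow> v \<in> V \<Longrightarrow> p (u + v) \<le> p u + p v"
  using assms unfolding is_norm_on_def by blast+

text \<open>
Along a line in a direction of \<open>V\<close>, the monotonicity-type bound on the gradient says that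
subtracting the parabola of curvature \<open>\<kappa>\<close> leaves a function whose derivative is nonpositive to
the right of the base point.
\<close>

lemma smooth_upper_bound:
  fixes f :: "'a::real_inner \<Rightarrow> real"
  assumes grad: "\<And>x. GDERIV f x :> g x" and V: "subspace V"
    and mono: "\<And>x h. h \<in> V \<Longrightarrow> (g (x + h) - g x) \<bullet> h \<le> \<kappa> * (norm h)\<^sup>2"
    and h: "h \<in> V"
  shows "f (x + h) \<le> f x + g x \<bullet> h + \<kappa> / 2 * (norm h)\<^sup>2"
proof -
  define \<phi> where "\<phi> t = f (x + t *\<^sub>R h) - t * (g x \<bullet> h) - \<kappa> / 2 * t\<^sup>2 * (norm h)\<^sup>2" for t
  have der: "(\<phi> has_real_derivative (g (x + t *\<^sub>R h) - g x) \<bullet> h - \<kappa> * t * (norm h)\<^sup>2) (at t)" for t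
  proof -
    have "((\<lambda>t. x + t *\<^sub>R h) has_derivative (\<lambda>s. s *\<^sub>R h)) (at t)"
      by (auto intro!: derivative_eq_intros)
    from diff_chain_at[OF this grad[of "x + t *\<^sub>R h", unfolded gderiv_def]]
    have "((\<lambda>t. f (x + t *\<^sub>R h)) has_derivative (\<lambda>s. s * (g (x + t *\<^sub>R h) \<bullet> h))) (at t)"
      by (simp add: o_def inner_commute)
    then have "((\<lambda>t. f (x + t *\<^sub>R h)) has_real_derivative g (x + t *\<^sub>R h) \<bullet> h) (at t)"
      by (simp add: has_field_derivative_def mult_commute_abs)
    then show ?thesis
      unfolding \<phi>_def by (auto intro!: derivative_eq_intros simp: inner_diff_left)
  qed
  have "(g (x + t *\<^sub>R h) - g x) \<bullet> h - \<kappa> * t * (norm h)\<^sup>2 \<le> 0" if "0 \<le> t" for t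
  proof (cases "t = 0")
    case False
    then have "0 < t" using that by simp
    have "t * ((g (x + t *\<^sub>R h) - g x) \<bullet> h) \<le> t * (\<kappa> * t * (norm h)\<^sup>2)"
      using mono[OF subspace_scale[OF V h, of t], of x]
      by (simp add: power_mult_distrib power2_eq_square mult_ac)
    then show ?thesis using \<open>0 < t\<close> by simp
  qed simp
  then have "\<phi> 1 \<le> \<phi> 0"
    by (intro DERIV_nonpos_imp_nonincreasing[of 0 1 \<phi>]) (use der in \<open>auto intro!: exI\<close>)
  then show ?thesis by (simp add: \<phi>_def)
qed

text \<open>
The Baillon--Haddad inequality, relative to a subspace \<open>V\<close> with orthogonal projection \<open>P\<close>.
Tilting \<open>f\<close> by its linearization at \<open>x\<close> turns \<open>x\<close> into a global minimizer, and a gradient step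
of length \<open>1 / \<kappa>\<close> inside \<open>V\<close> from any \<open>z\<close> cannot fall below the minimum.  Adding the resulting
inequality to the one with \<open>x\<close> and \<open>z\<close> exchanged gives the claim.
\<close>

lemma gradient_cocoercive:
  fixes f :: "'a::real_inner \<Rightarrow> real"
  assumes grad: "\<And>x. GDERIV f x :> g x" and cvx: "\<And>x z. f x + g x \<bullet> (z - x) \<le> f z"
    and V: "subspace V" and P: "\<And>u. P u \<in> V" "\<And>u v. v \<in> V \<Longrightarrow> P u \<bullet> v = u \<bullet> v"
    and mono: "\<And>x h. h \<in> V \<Longrightarrow> (g (x + h) - g x) \<bullet> h \<le> \<kappa> * (norm h)\<^sup>2"
    and \<kappa>: "0 < \<kappa>"
  shows "(norm (P (g (x + h) - g x)))\<^sup>2 \<le> \<kappa> * ((g (x + h) - g x) \<bullet> h)"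
proof -
  have one_sided: "f x + g x \<bullet> (z - x) + (norm (P (g z - g x)))\<^sup>2 / (2 * \<kappa>) \<le> f z" for x z
  proof -
    define u where "u = P (g z - g x)"
    have uV: "(- (1/\<kappa>)) *\<^sub>R u \<in> V"
      unfolding u_def by (intro subspace_scale V P)
    have u2: "(g z - g x) \<bullet> u = (norm u)\<^sup>2"
      using P(2)[of u "g z - g x"] P(1)
      by (simp add: u_def power2_norm_eq_inner)
    have "f x + g x \<bullet> (z + (- (1/\<kappa>)) *\<^sub>R u - x) \<le> f (z + (- (1/\<kappa>)) *\<^sub>R u)"
      by (rule cvx)
    also have "\<dots> \<le> f z + g z \<bullet> ((- (1/\<kappa>)) *\<^sub>R u) + \<kappa> / 2 * (norm ((- (1/\<kappa>)) *\<^sub>R u))\<^sup>2"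
      by (rule smooth_upper_bound[OF grad V mono uV])
    also have "\<kappa> / 2 * (norm ((- (1/\<kappa>)) *\<^sub>R u))\<^sup>2 = (norm u)\<^sup>2 / (2 * \<kappa>)"
      using \<kappa> by (simp add: power_divide power2_eq_square)
    finally have "f x + g x \<bullet> (z - x) + (1/\<kappa>) * ((g z - g x) \<bullet> u) \<le> f z + (norm u)\<^sup>2 / (2 * \<kappa>)"
      by (simp add: inner_diff_left inner_diff_right inner_add_right algebra_simps diff_divide_distrib)
    moreover have "(1/\<kappa>) * ((g z - g x) \<bullet> u) = (norm u)\<^sup>2 / (2 * \<kappa>) + (norm u)\<^sup>2 / (2 * \<kappa>)"
      using \<kappa> by (simp add: u2 field_simps)
    ultimately show ?thesis unfolding u_def by linarith
  qed
  have sym: "norm (P (g x - g (x + h))) = norm (P (g (x + h) - g x))"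
  proof -
    have "P u \<bullet> P u = P (- u) \<bullet> P (- u)" for u
      using P(2)[OF P(1), of u u] P(2)[OF P(1), of "-u" "-u"] P(2)[OF P(1), of u "-u"]
        P(2)[OF P(1), of "-u" u]
      by (simp add: inner_commute)
    from this[of "g x - g (x + h)"] show ?thesis by (simp add: norm_eq_sqrt_inner)
  qed
  have "(norm (P (g (x + h) - g x)))\<^sup>2 / \<kappa> \<le> (g (x + h) - g x) \<bullet> h"
    using one_sided[of x "x + h"] one_sided[of "x + h" x] \<kappa> unfolding sym
    by (simp add: inner_diff_left field_simps)
  then show ?thesis using \<kappa> by (simp add: field_simps)
qed

text \<open>
For a twice differentiable convex function this is the fact that the spectral radius of the Hessian,
which is its Euclidean norm by symmetry, is at most its operator norm for the norm \<open>p\<close>.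
Without second derivatives, an approximate top eigenvector is replaced by a pair of points: let \<open>\<kappa>\<close>
be the best Euclidean constant and choose a step \<open>k\<close> that almost attains it.  Cocoercivity turns
near-equality in the inner product into near-equality of vectors, so that the increment \<open>d\<close> of the
gradient is almost \<open>\<kappa> *\<^sub>R k\<close>.  Measured in \<open>p\<close>, the increment is at most \<open>L * p k\<close>, whence \<open>\<kappa> \<le> L\<close>.
\<close>

lemma lipschitz_gradient_norm_independent:
  fixes f :: "'a::real_inner \<Rightarrow> real"
  assumes grad: "\<And>x. GDERIV f x :> g x" and cvx: "\<And>x z. f x + g x \<bullet> (z - x) \<le> f z"
    and V: "subspace V" and P: "\<And>u. P u \<in> V" "\<And>u v. v \<in> V \<Longrightarrow> P u \<bullet> v = u \<bullet> v"
    and p: "is_norm_on V p" and p_ge: "\<And>v. v \<in> V \<Longrightarrow> norm v \<le> p v"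
    and p_le: "\<And>v. v \<in> V \<Longrightarrow> p v \<le> C * norm v" and C: "0 \<le> C"
    and lip: "\<And>x h. h \<in> V \<Longrightarrow> p (P (g (x + h) - g x)) \<le> L * p h" and L: "0 < L"
    and h: "h \<in> V"
  shows "(g (x + h) - g x) \<bullet> h \<le> L * (norm h)\<^sup>2"
proof (rule ccontr)
  assume neg: "\<not> ?thesis"
  define R where "R = {(g (x + h) - g x) \<bullet> h / (norm h)\<^sup>2 |x h. h \<in> V \<and> h \<noteq> 0}"
  define \<kappa> where "\<kappa> = Sup R"
  note p_nonneg = is_norm_onD(1)[OF p]
  have P_inner: "P u \<bullet> v = u \<bullet> v" if "v \<in> V" for u v using P(2) that by simp
  \<comment> \<open>The supremum \<open>\<kappa>\<close> is finite because \<open>p\<close> is equivalent to the Euclidean norm.\<close>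
  have le_LC: "(g (x + h) - g x) \<bullet> h \<le> L * C\<^sup>2 * (norm h)\<^sup>2" if "h \<in> V" for x h
  proof -
    have "(g (x + h) - g x) \<bullet> h \<le> norm (P (g (x + h) - g x)) * norm h"
      using P_inner[OF that, of "g (x + h) - g x"] norm_cauchy_schwarz by metis
    also have "\<dots> \<le> p (P (g (x + h) - g x)) * p h"
      by (intro mult_mono p_ge P that p_nonneg norm_ge_zero)
    also have "\<dots> \<le> L * p h * p h"
      by (intro mult_right_mono lip that p_nonneg)
    also have "\<dots> \<le> L * (C * norm h) * (C * norm h)"
      using L C by (intro mult_mono mult_left_mono mult_nonneg_nonneg p_le that p_nonneg norm_ge_zero order_refl) simp_all
    finally show ?thesis by (simp add: power2_eq_square mult_ac)
  qed
  have bdd: "bdd_above R"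
    unfolding R_def by (rule bdd_aboveI[of _ "L * C\<^sup>2"]) (auto simp: divide_le_eq le_LC)
  have le_\<kappa>: "(g (x + h) - g x) \<bullet> h \<le> \<kappa> * (norm h)\<^sup>2" if "h \<in> V" for x h
  proof (cases "h = 0")
    case False
    then have "(g (x + h) - g x) \<bullet> h / (norm h)\<^sup>2 \<le> \<kappa>"
      unfolding \<kappa>_def using that by (intro cSup_upper bdd) (auto simp: R_def)
    then show ?thesis using False by (simp add: divide_le_eq)
  qed simp
  have "h \<noteq> 0" using neg by auto
  then have in_R: "(g (x + h) - g x) \<bullet> h / (norm h)\<^sup>2 \<in> R" unfolding R_def using h by blast
  have "L * (norm h)\<^sup>2 < \<kappa> * (norm h)\<^sup>2"
    using neg le_\<kappa>[OF h, of x] by linarith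
  then have "L < \<kappa>" by (rule mult_right_less_imp_less) simp
  then have \<kappa>: "0 < \<kappa>" using L by simp
  \<comment> \<open>The tolerance makes the error \<open>norm (\<kappa> *\<^sub>R k - d)\<close> at most \<open>(\<kappa> - L) / (C + 1) * norm k\<close>;
    passing from the Euclidean norm to \<open>p\<close> costs a factor \<open>C\<close>, which still leaves less than \<open>\<kappa> - L\<close>.\<close>
  define \<epsilon> where "\<epsilon> = ((\<kappa> - L) / (C + 1))\<^sup>2 / \<kappa>"
  have "0 < \<epsilon>" unfolding \<epsilon>_def using \<kappa> C \<open>L < \<kappa>\<close> by simp
  then have "\<kappa> - \<epsilon> < Sup R" unfolding \<kappa>_def by simp
  then obtain x k where k: "k \<in> V" "k \<noteq> 0"
    and near: "\<kappa> - \<epsilon> < (g (x + k) - g x) \<bullet> k / (norm k)\<^sup>2"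
    using less_cSupD[of R "\<kappa> - \<epsilon>"] in_R unfolding R_def by blast
  define d where "d = P (g (x + k) - g x)"
  have dV: "d \<in> V" unfolding d_def by (rule P)
  have near': "(\<kappa> - \<epsilon>) * (norm k)\<^sup>2 \<le> d \<bullet> k"
    using near k by (simp add: less_divide_eq d_def P_inner)
  have "(norm d)\<^sup>2 \<le> \<kappa> * (d \<bullet> k)"
    using gradient_cocoercive[OF grad cvx V P le_\<kappa> \<kappa>, of x k] by (simp add: d_def P_inner k)
  then have "(norm (\<kappa> *\<^sub>R k - d))\<^sup>2 \<le> \<kappa> * (\<kappa> * (norm k)\<^sup>2 - d \<bullet> k)"
    unfolding power2_norm_eq_inner
    by (simp add: inner_diff_left inner_diff_right inner_commute algebra_simps)
  also have "\<dots> \<le> \<kappa> * (\<epsilon> * (norm k)\<^sup>2)"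
    using near' \<kappa> by (intro mult_left_mono) (auto simp: algebra_simps)
  also have "\<dots> = ((\<kappa> - L) / (C + 1) * norm k)\<^sup>2"
    using \<kappa> by (simp add: \<epsilon>_def power_mult_distrib power_divide)
  finally have small: "norm (\<kappa> *\<^sub>R k - d) \<le> (\<kappa> - L) / (C + 1) * norm k"
    by (rule power2_le_imp_le) (use C \<open>L < \<kappa>\<close> in auto)
  have pk: "0 < p k"
    using less_le_trans[OF _ p_ge[OF k(1)]] k(2) by simp
  have diffV: "\<kappa> *\<^sub>R k - d \<in> V" using V k dV by (simp add: subspace_diff subspace_scale)
  have "\<kappa> * p k = p (\<kappa> *\<^sub>R k)" using \<kappa> by (simp add: is_norm_onD(2)[OF p k(1)])
  also have "\<dots> = p (d + (\<kappa> *\<^sub>R k - d))" by simp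
  also have "\<dots> \<le> p d + p (\<kappa> *\<^sub>R k - d)" by (rule is_norm_onD(3)[OF p dV diffV])
  also have "\<dots> \<le> L * p k + C * ((\<kappa> - L) / (C + 1) * p k)"
  proof (intro add_mono)
    show "p d \<le> L * p k" unfolding d_def by (rule lip[OF k(1)])
    have "p (\<kappa> *\<^sub>R k - d) \<le> C * norm (\<kappa> *\<^sub>R k - d)" by (rule p_le[OF diffV])
    also have "\<dots> \<le> C * ((\<kappa> - L) / (C + 1) * norm k)" by (intro mult_left_mono small C)
    also have "\<dots> \<le> C * ((\<kappa> - L) / (C + 1) * p k)"
      using C \<open>L < \<kappa>\<close> p_ge[OF k(1)] by (intro mult_left_mono) auto
    finally show "p (\<kappa> *\<^sub>R k - d) \<le> C * ((\<kappa> - L) / (C + 1) * p k)" .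
  qed
  also have "\<dots> < \<kappa> * p k"
  proof -
    have "C * ((\<kappa> - L) / (C + 1)) < \<kappa> - L"
      using C \<open>L < \<kappa>\<close> mult_strict_right_mono[of C "C + 1" "\<kappa> - L"]
      by (simp add: pos_divide_less_eq mult.commute)
    then have "(L + C * ((\<kappa> - L) / (C + 1))) * p k < \<kappa> * p k"
      using pk by (intro mult_strict_right_mono) auto
    then show ?thesis by (simp add: algebra_simps)
  qed
  finally show False by simp
qed

section \<open>Blocks of coordinates\<close>

lemma linear_block_part: "linear (block_part blk i)"
  by (rule linearI) (auto simp: block_part_def vec_eq_iff)

lemmas block_part_simps =
  linear_add[OF linear_block_part] linear_diff[OF linear_block_part]
  linear_scale[OF linear_block_part] linear_neg[OF linear_block_part]

lemma block_part_in_block_space: "block_part blk i x \<in> block_space blk i"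
  by (simp add: block_part_def block_space_def)

lemma block_part_id: "x \<in> block_space blk i \<Longrightarrow> block_part blk i x = x"
  by (auto simp: block_part_def block_space_def vec_eq_iff)

lemma subspace_block_space: "subspace (block_space blk i)"
  by (auto simp: subspace_def block_space_def)

lemma block_part_block_part:
  "block_part blk i (block_part blk j x) = (if i = j then block_part blk j x else 0)"
  by (auto simp: block_part_def vec_eq_iff)

lemma inner_block_part:
  "block_part blk i x \<bullet> y = block_part blk i x \<bullet> block_part blk i y"
  by (auto simp: block_part_def inner_vec_def intro!: sum.cong)

lemma inner_eq_sum_blocks:
  fixes blk :: "'n::finite \<Rightarrow> 'b::finite"
  shows "x \<bullet> y = (\<Sum>i\<in>UNIV. block_part blk i x \<bullet> block_part blk i y)"
proof -
  have "(\<Sum>i\<in>UNIV. block_part blk i x \<bullet> block_part blk i y)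
      = (\<Sum>j\<in>UNIV. \<Sum>i\<in>UNIV. if blk j = i then x $ j * y $ j else 0)"
    unfolding block_part_def inner_vec_def
    by (subst sum.swap) (auto intro!: sum.cong)
  then show ?thesis by (simp add: inner_vec_def)
qed

text \<open>
Equivalence of norms in finite dimension: expand a vector in the unit vectors of its block and bound
each coordinate by the Euclidean norm.
\<close>

lemma is_norm_on_block_le_norm:
  fixes blk :: "'n::finite \<Rightarrow> 'b"
  assumes p: "is_norm_on (block_space blk i) p"
  obtains C where "0 \<le> C" "\<And>v. v \<in> block_space blk i \<Longrightarrow> p v \<le> C * norm v"
proof
  let ?V = "block_space blk i" and ?J = "{j. blk j = i}"
  let ?C = "\<Sum>j\<in>?J. p (axis j 1)"
  have axV: "axis j 1 \<in> ?V" if "blk j = i" for j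
    using that by (auto simp: block_space_def axis_def)
  note p_nonneg = is_norm_onD(1)[OF p] and p_scale = is_norm_onD(2)[OF p]
  show "0 \<le> ?C"
    by (intro sum_nonneg p_nonneg axV) simp
  have p0: "p 0 = 0"
    using p_scale[OF subspace_0[OF subspace_block_space], of 0] by simp
  have sum_le: "(\<Sum>j\<in>T. u j) \<in> ?V \<and> p (\<Sum>j\<in>T. u j) \<le> (\<Sum>j\<in>T. p (u j))"
    if "finite T" "\<And>j. j \<in> T \<Longrightarrow> u j \<in> ?V" for T :: "'n set" and u
    using that
  proof (induction T rule: finite_induct)
    case empty
    then show ?case by (simp add: p0 subspace_0 subspace_block_space)
  next
    case (insert j T)
    then have "u j \<in> ?V" "sum u T \<in> ?V" "p (sum u T) \<le> (\<Sum>j\<in>T. p (u j))" by auto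
    moreover from this have "p (u j + sum u T) \<le> p (u j) + p (sum u T)"
      by (intro is_norm_onD(3)[OF p])
    ultimately show ?case
      using insert.hyps by (simp add: subspace_add subspace_block_space)
  qed
  fix v assume v: "v \<in> ?V"
  have "v = (\<Sum>j\<in>?J. v $ j *\<^sub>R axis j 1)"
  proof -
    have "(\<Sum>j\<in>?J. v $ j *\<^sub>R axis j 1) $ l = v $ l" for l
    proof -
      have "(\<Sum>j\<in>?J. v $ j *\<^sub>R axis j 1) $ l = (\<Sum>j\<in>?J. if j = l then v $ l else 0)"
        unfolding sum_component by (intro sum.cong refl) (auto simp: axis_def)
      also have "\<dots> = v $ l" using v by (auto simp: block_space_def)
      finally show ?thesis .
    qed
    then show ?thesis by (simp only: vec_eq_iff simp_thms)
  qed
  also have "p (\<Sum>j\<in>?J. v $ j *\<^sub>R axis j 1) \<le> (\<Sum>j\<in>?J. p (v $ j *\<^sub>R axis j 1))"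
    using sum_le[of ?J "\<lambda>j. v $ j *\<^sub>R axis j 1"] axV
    by (auto intro!: subspace_scale subspace_block_space)
  also have "\<dots> \<le> (\<Sum>j\<in>?J. p (axis j 1) * norm v)"
  proof (rule sum_mono)
    fix j assume "j \<in> ?J"
    then have "p (v $ j *\<^sub>R axis j 1) = \<bar>v $ j\<bar> * p (axis j 1)" "0 \<le> p (axis j 1)"
      using axV[of j] by (simp_all add: p_nonneg p_scale)
    then show "p (v $ j *\<^sub>R axis j 1) \<le> p (axis j 1) * norm v"
      using mult_right_mono[OF component_le_norm_cart[of v j], of "p (axis j 1)"]
      by (simp only: mult.commute)
  qed
  finally show "p v \<le> ?C * norm v" by (simp add: sum_distrib_right)
qed

lemma wnorm_squared:
  "(wnorm blk nrm L t x)\<^sup>2 = (\<Sum>i\<in>UNIV. L i powr t * (nrm i (block_part blk i x))\<^sup>2)"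
  unfolding wnorm_def by (simp add: sum_nonneg)

lemma wnorm_euclidean_le:
  assumes "\<And>i h. h \<in> block_space blk i \<Longrightarrow> norm h \<le> nrm i h"
  shows "(wnorm blk (\<lambda>_. norm) L t x)\<^sup>2 \<le> (wnorm blk nrm L t x)\<^sup>2"
  unfolding wnorm_squared
  by (intro sum_mono mult_left_mono power_mono assms block_part_in_block_space) auto

text \<open>
Choosing the Euclidean norm on every block turns the weighted norm into an inner product norm.
Its square is convex; the auxiliary sequence of the algorithm is first averaged with \<open>y\<close>, and
this bounds the price of the averaging.
\<close>

lemma wnorm_euclidean_convex:
  assumes "0 \<le> b" "b \<le> 1"
  shows "(wnorm blk (\<lambda>_. norm) L t ((1 - b) *\<^sub>R u + b *\<^sub>R v))\<^sup>2
    \<le> (1 - b) * (wnorm blk (\<lambda>_. norm) L t u)\<^sup>2 + b * (wnorm blk (\<lambda>_. norm) L t v)\<^sup>2"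
proof -
  have sq: "(norm ((1 - b) *\<^sub>R r + b *\<^sub>R s))\<^sup>2 \<le> (1 - b) * (norm r)\<^sup>2 + b * (norm s)\<^sup>2"
    for r s :: "real^'n"
  proof -
    have "(1 - b) * (norm r)\<^sup>2 + b * (norm s)\<^sup>2 - (norm ((1 - b) *\<^sub>R r + b *\<^sub>R s))\<^sup>2
        = b * (1 - b) * (norm (r - s))\<^sup>2"
      unfolding power2_norm_eq_inner
      by (simp add: inner_add_left inner_add_right inner_diff_left inner_diff_right
          inner_commute[of s r] power2_eq_square algebra_simps)
    also have "\<dots> \<ge> 0" using assms by simp
    finally show ?thesis by simp
  qed
  have "L i powr t * (norm (block_part blk i ((1 - b) *\<^sub>R u + b *\<^sub>R v)))\<^sup>2
      \<le> (1 - b) * (L i powr t * (norm (block_part blk i u))\<^sup>2)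
        + b * (L i powr t * (norm (block_part blk i v))\<^sup>2)" for i
    using mult_left_mono[OF sq[of "block_part blk i u" "block_part blk i v"] powr_ge_zero[of "L i" t]]
    by (simp only: block_part_simps distrib_left mult.left_commute)
  then show ?thesis
    unfolding wnorm_squared sum_distrib_left sum.distrib[symmetric] by (rule sum_mono)
qed

text \<open>
The expansion of the square, where only block \<open>i\<close> contributes to the cross term.
This identity is what requires Euclidean block norms.
\<close>

lemma wnorm_euclidean_block_step:
  fixes blk :: "'n::finite \<Rightarrow> 'b::finite"
  shows "(wnorm blk (\<lambda>_. norm) L t (v + c *\<^sub>R block_part blk i r))\<^sup>2
    = (wnorm blk (\<lambda>_. norm) L t v)\<^sup>2
      + L i powr t * (2 * c * (block_part blk i r \<bullet> block_part blk i v)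
          + c\<^sup>2 * (norm (block_part blk i r))\<^sup>2)"
proof -
  have sq: "(norm (s + c *\<^sub>R q))\<^sup>2 = (norm s)\<^sup>2 + (2 * c * (q \<bullet> s) + c\<^sup>2 * (norm q)\<^sup>2)" for s q :: "real^'n"
    unfolding power2_norm_eq_inner
    by (simp add: inner_add_left inner_add_right inner_commute[of s q] power2_eq_square algebra_simps)
  have "(norm (block_part blk j (v + c *\<^sub>R block_part blk i r)))\<^sup>2
      = (norm (block_part blk j v))\<^sup>2 +
        (if j = i then 2 * c * (block_part blk i r \<bullet> block_part blk i v)
          + c\<^sup>2 * (norm (block_part blk i r))\<^sup>2 else 0)" for j
    by (simp add: block_part_simps block_part_block_part sq)
  then have "L j powr t * (norm (block_part blk j (v + c *\<^sub>R block_part blk i r)))\<^sup>2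
      = L j powr t * (norm (block_part blk j v))\<^sup>2 +
        (if j = i then L i powr t * (2 * c * (block_part blk i r \<bullet> block_part blk i v)
          + c\<^sup>2 * (norm (block_part blk i r))\<^sup>2) else 0)" for j
    by (simp add: distrib_left)
  then show ?thesis
    unfolding wnorm_squared by (simp only: sum.distrib sum.delta[OF finite] UNIV_I if_True)
qed

text \<open>
The Lipschitz condition compares gradients in the block norm, while the step moves along the Euclidean
gradient.  Independence of the norm shows that the same constant governs the Euclidean curvature
within a block, so that the step length \<open>1 / L i\<close> gives the usual decrease.
\<close>

lemma block_gradient_step:
  fixes f :: "real^'n \<Rightarrow> real" and blk :: "'n \<Rightarrow> 'b::finite"
  assumes grad: "\<And>x. GDERIV f x :> g x" and cvx: "\<And>x z. f x + g x \<bullet> (z - x) \<le> f z"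
    and nrm: "is_norm_on (block_space blk i) (nrm i)"
    and nrm_ge: "\<And>h. h \<in> block_space blk i \<Longrightarrow> norm h \<le> nrm i h"
    and lip: "block_lipschitz blk nrm L g"
  shows "f (y - (1 / L i) *\<^sub>R block_part blk i (g y))
    \<le> f y - (norm (block_part blk i (g y)))\<^sup>2 / (2 * L i)"
proof -
  obtain C where C: "0 \<le> C" "\<And>v. v \<in> block_space blk i \<Longrightarrow> nrm i v \<le> C * norm v"
    using is_norm_on_block_le_norm[OF nrm] by blast
  have L: "0 < L i" using lip by (simp add: block_lipschitz_def)
  have P: "block_part blk i u \<bullet> v = u \<bullet> v" if "v \<in> block_space blk i" for u v
    using inner_block_part[of blk i v u] block_part_id[OF that] by (simp add: inner_commute)
  have mono: "(g (x + h) - g x) \<bullet> h \<le> L i * (norm h)\<^sup>2" if "h \<in> block_space blk i" for x h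
    using lip that
    by (intro lipschitz_gradient_norm_independent[where V = "block_space blk i"
          and P = "block_part blk i" and p = "nrm i" and C = C, OF grad cvx])
       (auto simp: subspace_block_space block_part_in_block_space P nrm nrm_ge C L block_lipschitz_def)
  let ?u = "block_part blk i (g y)"
  have uV: "(- (1 / L i)) *\<^sub>R ?u \<in> block_space blk i"
    by (intro subspace_scale subspace_block_space block_part_in_block_space)
  have "f (y + (- (1 / L i)) *\<^sub>R ?u)
      \<le> f y + g y \<bullet> ((- (1 / L i)) *\<^sub>R ?u) + L i / 2 * (norm ((- (1 / L i)) *\<^sub>R ?u))\<^sup>2"
    by (rule smooth_upper_bound[OF grad subspace_block_space mono uV])
  also have "g y \<bullet> ((- (1 / L i)) *\<^sub>R ?u) = - (norm ?u)\<^sup>2 / L i"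
    using inner_block_part[of blk i "g y" "g y"]
    by (simp add: power2_norm_eq_inner inner_commute)
  also have "L i / 2 * (norm ((- (1 / L i)) *\<^sub>R ?u))\<^sup>2 = (norm ?u)\<^sup>2 / (2 * L i)"
    using L by (simp add: power_divide power2_eq_square)
  finally show ?thesis using L by (simp add: field_simps)
qed

section \<open>Growth of the scalar sequences\<close>

lemma acd_scalars_bounds:
  assumes s: "acd_scalars L \<alpha> \<sigma> a A B" and \<sigma>: "0 \<le> \<sigma>"
  shows "0 \<le> A k" "1 \<le> B k"
proof -
  have "0 \<le> A k \<and> 1 \<le> B k"
  proof (induction k)
    case (Suc k)
    have "0 < a (Suc k)" "A (Suc k) = A k + a (Suc k)" "B (Suc k) = B k + \<sigma> * a (Suc k)"
      using s by (auto simp: acd_scalars_def)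
    then show ?case using Suc \<sigma> by (simp add: add_increasing2)
  qed (use s in \<open>simp add: acd_scalars_def\<close>)
  then show "0 \<le> A k" "1 \<le> B k" by auto
qed

lemma Lsum_pos:
  fixes L :: "'b::finite \<Rightarrow> real"
  assumes "\<And>i. 0 < L i" shows "0 < Lsum L t"
  unfolding Lsum_def using assms by (intro sum_pos) (auto simp: less_imp_neq[symmetric])

text \<open>
Since \<open>B\<close> is at least \<open>1\<close>, the quadratic equation gives
\<open>A (Suc k) - A k = a (Suc k) \<ge> sqrt (A (Suc k)) / S\<close>.  Factoring the difference as a difference of
squares shows that \<open>sqrt A\<close> grows by at least \<open>1 / (2 * S)\<close> per step.
\<close>

lemma acd_scalars_growth:
  fixes L :: "'b::finite \<Rightarrow> real"
  assumes s: "acd_scalars L \<alpha> \<sigma> a A B" and \<sigma>: "0 \<le> \<sigma>" and L: "\<And>i. 0 < L i"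
  shows "(real k)\<^sup>2 \<le> 4 * (Lsum L (\<alpha> / 2))\<^sup>2 * A k"
proof -
  define S where "S = Lsum L (\<alpha> / 2)"
  have S: "0 < S" unfolding S_def by (rule Lsum_pos[OF L])
  have "real k \<le> 2 * S * sqrt (A k)"
  proof (induction k)
    case (Suc k)
    let ?r = "sqrt (A k)" and ?r' = "sqrt (A (Suc k))"
    have a: "0 < a (Suc k)" and A: "A (Suc k) = A k + a (Suc k)"
      and eq: "(a (Suc k))\<^sup>2 * S\<^sup>2 = A (Suc k) * B (Suc k)"
      using s by (auto simp: acd_scalars_def S_def)
    note Ak = acd_scalars_bounds(1)[OF s \<sigma>, of k] and Bk = acd_scalars_bounds(2)[OF s \<sigma>, of "Suc k"]
    have A': "0 < A (Suc k)" using A a Ak by simp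
    have "A (Suc k) * 1 \<le> A (Suc k) * B (Suc k)"
      using A' Bk by (intro mult_left_mono) auto
    also have "\<dots> = (a (Suc k) * S)\<^sup>2" by (simp only: eq power_mult_distrib)
    finally have "?r'\<^sup>2 \<le> (a (Suc k) * S)\<^sup>2" using A' by simp
    then have "?r' \<le> a (Suc k) * S"
      by (rule power2_le_imp_le) (use a S in simp)
    also have "a (Suc k) = ?r'\<^sup>2 - ?r\<^sup>2" using A A' Ak by simp
    also have "\<dots> = (?r' - ?r) * (?r' + ?r)" by (simp add: power2_eq_square algebra_simps)
    also have "(?r' - ?r) * (?r' + ?r) * S \<le> (?r' - ?r) * (2 * ?r') * S"
      using A a S by (intro mult_right_mono mult_left_mono) auto
    finally have "?r' * 1 \<le> ?r' * (2 * S * (?r' - ?r))"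
      by (simp only: mult_1_right mult_ac)
    then have "1 \<le> 2 * S * (?r' - ?r)" using A' by (simp only: mult_le_cancel_left_pos real_sqrt_gt_zero)
    then show ?case using Suc by (simp add: algebra_simps)
  qed (use s in \<open>simp add: acd_scalars_def\<close>)
  then have "(real k)\<^sup>2 \<le> (2 * S * sqrt (A k))\<^sup>2" by (intro power_mono) auto
  then show ?thesis
    using acd_scalars_bounds(1)[OF s \<sigma>, of k] by (simp add: S_def power_mult_distrib)
qed

section \<open>Decrease of the potential\<close>

text \<open>
One step decreases the potential
\<open>2 * A * (f x - f z) + B * Q (\<nu> - z)\<close> on average over the sampled block.
Three cancellations make it work.

\<^item> The step of \<open>\<nu>\<close> is divided by the probability of the block, so its cross term averages to the full
  inner product of the gradient with \<open>w - z\<close>, where \<open>w\<close> is the mixture of \<open>\<nu>\<close> and \<open>y\<close>.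
\<^item> The exponent \<open>\<alpha> / 2\<close> of the probabilities together with the quadratic equation for \<open>a\<close> makes
  \<open>B'\<close> times the squared length of the \<open>\<nu>\<close>-step equal to \<open>2 * A'\<close> times the guaranteed decrease of
  \<open>f\<close>, for every block.
\<^item> The definition of \<open>y\<close> says \<open>a *\<^sub>R (w - y) = A *\<^sub>R (y - x)\<close>, so convexity between \<open>x\<close> and \<open>y\<close> and
  strong convexity between \<open>z\<close> and \<open>y\<close> handle the remaining inner product.  The strong convexity
  term pays for the averaging with \<open>y\<close>.
\<close>

lemma acd_step_potential:
  fixes f :: "real^'n \<Rightarrow> real" and blk :: "'n \<Rightarrow> 'b::finite"
    and a A A' B B' \<alpha> \<sigma> :: real and L :: "'b \<Rightarrow> real"
  defines "Q \<equiv> \<lambda>v. (wnorm blk (\<lambda>_. norm) L (1 - \<alpha>) v)\<^sup>2"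
  assumes L: "\<And>i. 0 < L i"
    and descent: "\<And>i y. f (y - (1 / L i) *\<^sub>R block_part blk i (g y))
        \<le> f y - (norm (block_part blk i (g y)))\<^sup>2 / (2 * L i)"
    and sc: "strongly_convex f g (wnorm blk (\<lambda>_. norm) L (1 - \<alpha>)) \<sigma>"
    and a: "0 < a" and A: "0 \<le> A" and B: "0 < B"
    and A': "A' = A + a" and B': "B' = B + \<sigma> * a" and quad: "a\<^sup>2 * (Lsum L (\<alpha> / 2))\<^sup>2 = A' * B'"
    and y: "y = (1 / (1 - a / A' * (\<sigma> * a / B'))) *\<^sub>R
        ((1 - a / A') *\<^sub>R x + (a / A' * (1 - \<sigma> * a / B')) *\<^sub>R \<nu>)"
    and X: "\<And>i. X i = y + (1 / L i) *\<^sub>R (- block_part blk i (g y))"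
    and V: "\<And>i. V i = (1 - \<sigma> * a / B') *\<^sub>R \<nu> + (\<sigma> * a / B') *\<^sub>R y
        + (a / (L i powr (1 - \<alpha>) * B' * Lprob L (\<alpha> / 2) i)) *\<^sub>R (- block_part blk i (g y))"
  shows "(\<Sum>i\<in>UNIV. Lprob L (\<alpha> / 2) i * (2 * A' * (f (X i) - f z) + B' * Q (V i - z)))
    \<le> 2 * A * (f x - f z) + B * Q (\<nu> - z)"
proof -
  define b where "b = \<sigma> * a / B'"
  define w where "w = (1 - b) *\<^sub>R \<nu> + b *\<^sub>R y"
  define S where "S = Lsum L (\<alpha> / 2)"
  define p where "p i = Lprob L (\<alpha> / 2) i" for i
  define u where "u i = block_part blk i (g y)" for i
  have \<sigma>: "0 \<le> \<sigma>" using sc by (simp add: strongly_convex_def)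
  have sc': "f r + g r \<bullet> (t - r) + \<sigma> / 2 * Q (t - r) \<le> f t" for r t
    using sc by (simp add: strongly_convex_def Q_def)
  have Q_nonneg: "0 \<le> Q v" for v by (simp add: Q_def)
  have Q_minus: "Q (r - t) = Q (t - r)" for r t
    unfolding Q_def wnorm_squared by (simp add: block_part_simps norm_minus_commute)
  have cvx: "f r + g r \<bullet> (t - r) \<le> f t" for r t
    using sc'[of r t] mult_nonneg_nonneg[of "\<sigma> / 2", OF _ Q_nonneg[of "t - r"]] \<sigma> by simp
  have A'pos: "0 < A'" using A' a A by simp
  have B'pos: "0 < B'" using B' B \<sigma> a by (simp add: add_pos_nonneg)
  have b: "0 \<le> b" "b < 1" using \<sigma> a B B' B'pos by (auto simp: b_def)
  have b_eq: "B' * b = \<sigma> * a" using B'pos by (simp add: b_def)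
  then have b_eq': "B' * (1 - b) = B" using B' by (simp add: right_diff_distrib)
  have S: "0 < S" unfolding S_def by (rule Lsum_pos[OF L])
  have p: "0 < p i" for i using L[of i] S by (simp add: p_def Lprob_def S_def)
  have p_sum: "(\<Sum>i\<in>UNIV. p i) = 1"
    using S by (simp add: p_def Lprob_def S_def[symmetric] sum_divide_distrib[symmetric])
       (simp add: S_def Lsum_def)
  \<comment> \<open>The defining equation of \<open>y\<close>, cleared of denominators; \<open>b < 1\<close> makes its divisor nonzero.\<close>
  have key: "a * (w - y) $ j = A * (y - x) $ j" for j
  proof -
    have "a / A' * b \<le> 1 * b" using A A' a A'pos b by (intro mult_right_mono) auto
    then have ne: "1 - a / A' * b \<noteq> 0" using b by linarith
    have "(1 - a / A' * b) *\<^sub>R y = (1 - a / A') *\<^sub>R x + (a / A' * (1 - b)) *\<^sub>R \<nu>"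
    proof -
      have cancel: "c *\<^sub>R ((1 / c) *\<^sub>R r) = r" if "c \<noteq> 0" for c and r :: "real^'n"
        using that by simp
      show ?thesis
        unfolding y b_def[symmetric] by (rule cancel[OF ne])
    qed
    then have "(1 - a / A' * b) * y $ j = (1 - a / A') * x $ j + (a / A' * (1 - b)) * \<nu> $ j"
      by (metis vector_add_component vector_scaleR_component real_scaleR_def)
    then have "A' * ((1 - a / A' * b) * y $ j) = A' * ((1 - a / A') * x $ j + (a / A' * (1 - b)) * \<nu> $ j)"
      by simp
    then have "(A' - a * b) * y $ j = (A' - a) * x $ j + a * (1 - b) * \<nu> $ j"
      using A'pos by (simp add: distrib_left mult.assoc[symmetric] right_diff_distrib)
    then show ?thesis by (simp add: A' w_def algebra_simps)
  qed
  then have key: "a *\<^sub>R (w - y) = A *\<^sub>R (y - x)" by (simp add: vec_eq_iff)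
  \<comment> \<open>After multiplication with the probability, the two terms \<open>A' * p i / L i * (norm (u i))\<^sup>2\<close>
    from the \<open>\<nu>\<close>-step and from the descent of \<open>f\<close> cancel.\<close>
  have one: "p i * (2 * A' * (f (X i) - f z) + B' * Q (V i - z))
      \<le> p i * (2 * A' * (f y - f z) + B' * Q (w - z))
        - 2 * a * (u i \<bullet> block_part blk i (w - z))" for i
  proof -
    define c where "c = a / (L i powr (1 - \<alpha>) * B' * p i)"
    have Lp: "0 < L i powr (1 - \<alpha>)" using L[of i] by simp
    have c1: "B' * p i * (L i powr (1 - \<alpha>) * c) = a"
      using Lp B'pos p[of i] by (simp add: c_def)
    \<comment> \<open>The weights balance because \<open>p i\<close> carries half of the exponent \<open>\<alpha>\<close>.\<close>
    have pS: "(p i)\<^sup>2 * S\<^sup>2 * L i powr (1 - \<alpha>) = L i"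
    proof -
      have "(p i)\<^sup>2 * S\<^sup>2 = L i powr \<alpha>"
        using S by (simp add: p_def Lprob_def S_def[symmetric] power_divide power2_eq_square
            powr_add[symmetric])
      then show ?thesis using L[of i] by (simp add: powr_add[symmetric])
    qed
    have c2: "B' * p i * (L i powr (1 - \<alpha>) * c\<^sup>2) = A' * p i / L i"
    proof -
      have "B' * p i * (L i powr (1 - \<alpha>) * c\<^sup>2) = a * c"
        using c1 by (metis (no_types, lifting) mult.assoc power2_eq_square)
      also have "\<dots> = (a\<^sup>2 * S\<^sup>2) * p i / (B' * ((p i)\<^sup>2 * S\<^sup>2 * L i powr (1 - \<alpha>)))"
        using S p[of i] Lp B'pos by (simp add: c_def power2_eq_square)
      also have "\<dots> = A' * p i / L i"
        unfolding pS using quad B'pos by (simp add: S_def)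
      finally show ?thesis .
    qed
    have "V i - z = (w - z) + (- c) *\<^sub>R block_part blk i (g y)"
      by (simp add: V w_def b_def c_def p_def)
    then have "Q (V i - z) = Q (w - z)
        + L i powr (1 - \<alpha>) * (2 * (- c) * (u i \<bullet> block_part blk i (w - z)) + c\<^sup>2 * (norm (u i))\<^sup>2)"
      unfolding Q_def u_def by (simp only: wnorm_euclidean_block_step power2_minus)
    then have "p i * (B' * Q (V i - z)) = p i * (B' * Q (w - z))
        - 2 * (B' * p i * (L i powr (1 - \<alpha>) * c)) * (u i \<bullet> block_part blk i (w - z))
        + B' * p i * (L i powr (1 - \<alpha>) * c\<^sup>2) * (norm (u i))\<^sup>2"
      by (simp only:) (simp add: algebra_simps)
    also have "\<dots> = p i * (B' * Q (w - z)) - 2 * a * (u i \<bullet> block_part blk i (w - z))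
        + A' * p i / L i * (norm (u i))\<^sup>2"
      unfolding c1 c2 ..
    finally have QV: "p i * (B' * Q (V i - z)) = p i * (B' * Q (w - z))
        - 2 * a * (u i \<bullet> block_part blk i (w - z)) + A' * p i / L i * (norm (u i))\<^sup>2" .
    have "f (X i) \<le> f y - (norm (u i))\<^sup>2 / (2 * L i)"
      using descent[of y i] by (simp add: X u_def)
    then have "p i * (2 * A') * (f (X i) - f z)
        \<le> p i * (2 * A') * (f y - (norm (u i))\<^sup>2 / (2 * L i) - f z)"
      using p[of i] A'pos by (intro mult_left_mono) auto
    also have "\<dots> = p i * (2 * A' * (f y - f z)) - A' * p i / L i * (norm (u i))\<^sup>2"
      using L[of i] by (simp add: field_simps)
    finally show ?thesis using QV by (simp add: distrib_left mult.assoc)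
  qed
  have "(\<Sum>i\<in>UNIV. p i * (2 * A' * (f (X i) - f z) + B' * Q (V i - z)))
      \<le> (\<Sum>i\<in>UNIV. p i * (2 * A' * (f y - f z) + B' * Q (w - z))
          - 2 * a * (u i \<bullet> block_part blk i (w - z)))"
    by (intro sum_mono one)
  also have "\<dots> = 2 * A' * (f y - f z) + B' * Q (w - z) - 2 * a * (g y \<bullet> (w - z))"
    unfolding u_def inner_eq_sum_blocks[of "g y" "w - z" blk]
    by (simp add: sum_subtractf sum_distrib_left[symmetric] sum_distrib_right[symmetric] p_sum)
  finally have averaged: "(\<Sum>i\<in>UNIV. p i * (2 * A' * (f (X i) - f z) + B' * Q (V i - z)))
      \<le> 2 * A' * (f y - f z) + B' * Q (w - z) - 2 * a * (g y \<bullet> (w - z))" .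
  have Q_mix: "B' * Q (w - z) \<le> B * Q (\<nu> - z) + \<sigma> * a * Q (y - z)"
  proof -
    have "w - z = (1 - b) *\<^sub>R (\<nu> - z) + b *\<^sub>R (y - z)"
      by (simp add: w_def algebra_simps)
    then have "Q (w - z) \<le> (1 - b) * Q (\<nu> - z) + b * Q (y - z)"
      unfolding Q_def using wnorm_euclidean_convex[of b] b by simp
    then have "B' * Q (w - z) \<le> B' * ((1 - b) * Q (\<nu> - z) + b * Q (y - z))"
      using B'pos by simp
    then show ?thesis by (simp add: distrib_left mult.assoc[symmetric] b_eq b_eq')
  qed
  have coupling: "a * (g y \<bullet> (w - z)) = - A * (g y \<bullet> (x - y)) - a * (g y \<bullet> (z - y))"
  proof -
    have "a * (g y \<bullet> (w - z)) = g y \<bullet> (a *\<^sub>R (w - y)) - a * (g y \<bullet> (z - y))"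
      by (simp add: inner_diff_right algebra_simps)
    then show ?thesis unfolding key by (simp add: inner_diff_right algebra_simps)
  qed
  have "A * (g y \<bullet> (x - y)) \<le> A * (f x - f y)"
    using cvx[of y x] A by (intro mult_left_mono) auto
  moreover have "a * (g y \<bullet> (z - y)) \<le> a * (f z - f y - \<sigma> / 2 * Q (y - z))"
    using sc'[of y z] a by (intro mult_left_mono) (auto simp: Q_minus[of y z])
  ultimately show ?thesis
    using averaged Q_mix coupling unfolding p_def by (simp add: A' algebra_simps)
qed

section \<open>Expectations along independent draws\<close>

context prob_space begin

lemma prob_history:
  assumes indep: "indep_vars (\<lambda>_. count_space UNIV) I (UNIV :: nat set)"
    and p: "\<And>k i. prob {w \<in> space M. I k w = i} = p i"
  shows "prob {w \<in> space M. map (\<lambda>j. I j w) [0..<length l] = l} = prod_list (map p l)"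
proof (cases "l = []")
  case True
  then show ?thesis using prob_space by simp
next
  case False
  have one: "I j -` {i} \<inter> space M = {w \<in> space M. I j w = i}" for j i
    by blast
  have "prob (\<Inter>j\<in>{..<length l}. I j -` {l ! j} \<inter> space M)
      = (\<Prod>j\<in>{..<length l}. prob (I j -` {l ! j} \<inter> space M))"
    by (rule indep_varsD[OF indep]) (use False in \<open>simp_all add: lessThan_empty_iff\<close>)
  also have "\<dots> = (\<Prod>j<length l. p (l ! j))"
    by (simp only: one p)
  also have "(\<Inter>j\<in>{..<length l}. I j -` {l ! j} \<inter> space M)
      = {w \<in> space M. map (\<lambda>j. I j w) [0..<length l] = l}"
  proof -
    have "(map (\<lambda>j. I j w) [0..<length l] = l) \<longleftrightarrow> (\<forall>j<length l. I j w = l ! j)" for w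
      by (subst list_eq_iff_nth_eq) auto
    then show ?thesis using False by (simp only: one) auto
  qed
  also have "(\<Prod>j<length l. p (l ! j)) = prod_list (map p l)"
    by (simp add: prod.list_conv_set_nth atLeast0LessThan)
  finally show ?thesis .
qed

text \<open>
A quantity that depends on the first \<open>k\<close> draws only takes finitely many values, so its expectation is
a finite sum over histories, and measurability is automatic.
\<close>

lemma expectation_history:
  fixes I :: "nat \<Rightarrow> 'a \<Rightarrow> 'b::finite" and h :: "'b list \<Rightarrow> real"
  assumes indep: "indep_vars (\<lambda>_. count_space UNIV) I UNIV"
    and p: "\<And>k i. prob {w \<in> space M. I k w = i} = p i"
  shows "integrable M (\<lambda>w. h (map (\<lambda>j. I j w) [0..<k]))"
    and "expectation (\<lambda>w. h (map (\<lambda>j. I j w) [0..<k]))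
      = (\<Sum>l | length l = k. prod_list (map p l) * h l)"
proof -
  let ?E = "\<lambda>l. {w \<in> space M. map (\<lambda>j. I j w) [0..<length l] = l}"
  have fin: "finite {l :: 'b list. length l = k}"
    using finite_lists_length_eq[of "UNIV :: 'b set" k] by simp
  have meas: "I j \<in> measurable M (count_space UNIV)" for j
    using indep by (auto simp: indep_vars_def)
  have ev: "?E l \<in> events" for l
  proof -
    have "?E l = {w \<in> space M. \<forall>j\<in>{..<length l}. I j w = l ! j}"
      by (subst list_eq_iff_nth_eq) auto
    also have "\<dots> \<in> events"
      using meas by measurable
    finally show ?thesis .
  qed
  have eq: "h (map (\<lambda>j. I j w) [0..<k]) = (\<Sum>l | length l = k. h l * indicator (?E l) w)"
    if "w \<in> space M" for w
  proof -
    have "(\<Sum>l | length l = k. h l * indicator (?E l) w)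
        = (\<Sum>l | length l = k. if l = map (\<lambda>j. I j w) [0..<k] then h l else 0)"
      using that by (intro sum.cong) (auto simp: indicator_def)
    then show ?thesis using fin by simp
  qed
  have int: "integrable M (\<lambda>w. h l * indicator (?E l) w)" for l
    using ev by (intro integrable_mult_right integrable_real_indicator) (auto simp: emeasure_eq_measure)
  show "integrable M (\<lambda>w. h (map (\<lambda>j. I j w) [0..<k]))"
    using int by (subst Bochner_Integration.integrable_cong[OF refl eq]) auto
  have "expectation (\<lambda>w. h (map (\<lambda>j. I j w) [0..<k]))
      = expectation (\<lambda>w. \<Sum>l | length l = k. h l * indicator (?E l) w)"
    by (rule Bochner_Integration.integral_cong[OF refl eq])
  also have "\<dots> = (\<Sum>l | length l = k. h l * prob (?E l))"
    by (subst Bochner_Integration.integral_sum[OF int]) (simp add: Int_absorb2 sets.sets_into_space ev)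
  also have "\<dots> = (\<Sum>l | length l = k. prod_list (map p l) * h l)"
    by (simp only: prob_history[OF indep p] mult.commute)
  finally show "expectation (\<lambda>w. h (map (\<lambda>j. I j w) [0..<k]))
      = (\<Sum>l | length l = k. prod_list (map p l) * h l)" .
qed

text \<open>
A process driven by independent draws is a function of the history of draws.  Splitting off the last
draw in the sum over histories turns a potential that decreases on average in one step, from every
state, into one that decreases in expectation along the process.
\<close>

lemma expectation_potential_le:
  fixes I :: "nat \<Rightarrow> 'a \<Rightarrow> 'b::finite" and s :: "nat \<Rightarrow> 'a \<Rightarrow> 's"
    and \<Phi> :: "nat \<Rightarrow> 's \<Rightarrow> real"
  assumes indep: "indep_vars (\<lambda>_. count_space UNIV) I UNIV"
    and p: "\<And>k i. prob {w \<in> space M. I k w = i} = p i"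
    and init: "\<And>w. w \<in> space M \<Longrightarrow> s 0 w = s0"
    and step: "\<And>k w. w \<in> space M \<Longrightarrow> s (Suc k) w = step k (s k w) (I k w)"
    and decrease: "\<And>k r. (\<Sum>i\<in>UNIV. p i * \<Phi> (Suc k) (step k r i)) \<le> \<Phi> k r"
  shows "integrable M (\<lambda>w. h (s k w) :: real)"
    and "expectation (\<lambda>w. \<Phi> k (s k w)) \<le> \<Phi> 0 s0"
proof -
  define S where "S l = foldl (\<lambda>r (k, i). step k r i) s0 (List.enumerate 0 l)" for l
  have S_simps: "S [] = s0" "S (l @ [i]) = step (length l) (S l) i" for l i
    by (simp_all add: S_def enumerate_append_eq)
  have s_eq: "s k w = S (map (\<lambda>j. I j w) [0..<k])" if "w \<in> space M" for k w
    by (induction k) (simp_all add: init step that S_simps)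
  have cong: "integrable M (\<lambda>w. h (s k w)) \<longleftrightarrow> integrable M (\<lambda>w. h (S (map (\<lambda>j. I j w) [0..<k])))"
    for h :: "'s \<Rightarrow> real"
    by (rule Bochner_Integration.integrable_cong) (simp_all add: s_eq)
  show "integrable M (\<lambda>w. h (s k w))"
    unfolding cong by (rule expectation_history[OF indep p])
  have p_nonneg: "0 \<le> prod_list (map p l)" for l
    by (simp add: prob_history[OF indep p, symmetric])
  have "(\<Sum>l | length l = k. prod_list (map p l) * \<Phi> k (S l)) \<le> \<Phi> 0 s0"
  proof (induction k)
    case (Suc k)
    have split: "{l :: 'b list. length l = Suc k} = (\<lambda>(l, i). l @ [i]) ` ({l. length l = k} \<times> UNIV)"
      by (auto simp: image_iff length_Suc_conv_rev)
    have "(\<Sum>l | length l = Suc k. prod_list (map p l) * \<Phi> (Suc k) (S l))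
        = (\<Sum>l | length l = k. \<Sum>i\<in>UNIV. prod_list (map p l) * p i * \<Phi> (Suc k) (step k (S l) i))"
      unfolding split sum.cartesian_product
      by (subst sum.reindex) (auto simp: inj_on_def S_simps intro!: sum.cong)
    also have "\<dots> = (\<Sum>l | length l = k. prod_list (map p l) *
        (\<Sum>i\<in>UNIV. p i * \<Phi> (Suc k) (step k (S l) i)))"
      by (simp add: sum_distrib_left mult.assoc)
    also have "\<dots> \<le> (\<Sum>l | length l = k. prod_list (map p l) * \<Phi> k (S l))"
      by (intro sum_mono mult_left_mono decrease p_nonneg)
    finally show ?case using Suc by simp
  qed (simp add: S_simps)
  moreover have "expectation (\<lambda>w. \<Phi> k (s k w)) = expectation (\<lambda>w. \<Phi> k (S (map (\<lambda>j. I j w) [0..<k])))"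
    by (rule Bochner_Integration.integral_cong) (simp_all add: s_eq)
  ultimately show "expectation (\<lambda>w. \<Phi> k (s k w)) \<le> \<Phi> 0 s0"
    using expectation_history(2)[OF indep p, where h = "\<lambda>l. \<Phi> k (S l)" and k = k] by simp
qed

end

text \<open>
The negative part of the smaller function has the larger integral, so both parts of the extended
expectation compare in the right direction.  Monotonicity of the nonnegative integral holds for
arbitrary functions, which suits \<open>F \<circ> Bop\<close> with its arbitrary operator.
\<close>

lemma ereal_expectation_le_integral:
  assumes int: "integrable M Y" and le: "AE w in M. X w \<le> ereal (Y w)"
  shows "ereal_expectation M X \<le> ereal (integral\<^sup>L M Y)"
proof -
  have pos: "(\<integral>\<^sup>+ w. e2ennreal (X w) \<partial>M) \<le> (\<integral>\<^sup>+ w. ennreal (Y w) \<partial>M)"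
    using le by (intro nn_integral_mono_AE) (auto elim!: eventually_mono simp: ennreal.rep_eq
        dest: e2ennreal_mono)
  have neg: "(\<integral>\<^sup>+ w. ennreal (- Y w) \<partial>M) \<le> (\<integral>\<^sup>+ w. e2ennreal (- X w) \<partial>M)"
  proof (intro nn_integral_mono_AE eventually_mono[OF le])
    fix w assume "X w \<le> ereal (Y w)"
    then have "ereal (- Y w) \<le> - X w" by (metis ereal_minus_le_minus uminus_ereal.simps(1))
    from e2ennreal_mono[OF this] show "ennreal (- Y w) \<le> e2ennreal (- X w)" by simp
  qed
  have fin: "(\<integral>\<^sup>+ w. ennreal (Y w) \<partial>M) \<noteq> \<infinity>" "(\<integral>\<^sup>+ w. ennreal (- Y w) \<partial>M) \<noteq> \<infinity>"
    using int by (auto simp: real_integrable_def)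
  have "ereal_expectation M X \<le> enn2ereal (\<integral>\<^sup>+ w. ennreal (Y w) \<partial>M) - enn2ereal (\<integral>\<^sup>+ w. ennreal (- Y w) \<partial>M)"
    unfolding ereal_expectation_def
    using pos neg by (intro ereal_minus_mono) (auto simp: less_eq_ennreal.rep_eq)
  also have "\<dots> = ereal (integral\<^sup>L M Y)"
    using fin unfolding real_lebesgue_integral_def[OF int]
    by (cases "\<integral>\<^sup>+ w. ennreal (Y w) \<partial>M"; cases "\<integral>\<^sup>+ w. ennreal (- Y w) \<partial>M")
       (auto simp: enn2ereal_ennreal)
  finally show ?thesis .
qed

section \<open>The convergence rate\<close>

definition acd_mix :: "real \<Rightarrow> (nat \<Rightarrow> real) \<Rightarrow> (nat \<Rightarrow> real) \<Rightarrow> (nat \<Rightarrow> real) \<Rightarrow> nat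
    \<Rightarrow> (real^'n) \<times> (real^'n) \<Rightarrow> real^'n" where
  "acd_mix \<sigma> a A B k s =
     (1 / (1 - a (Suc k) / A (Suc k) * (\<sigma> * a (Suc k) / B (Suc k)))) *\<^sub>R
       ((1 - a (Suc k) / A (Suc k)) *\<^sub>R fst s
         + (a (Suc k) / A (Suc k) * (1 - \<sigma> * a (Suc k) / B (Suc k))) *\<^sub>R snd s)"

definition acd_update :: "('n \<Rightarrow> 'b::finite) \<Rightarrow> ('b \<Rightarrow> real) \<Rightarrow> (real^'n \<Rightarrow> real^'n) \<Rightarrow> real \<Rightarrow> real
    \<Rightarrow> (nat \<Rightarrow> real) \<Rightarrow> (nat \<Rightarrow> real) \<Rightarrow> (nat \<Rightarrow> real) \<Rightarrow> nat
    \<Rightarrow> (real^'n) \<times> (real^'n) \<Rightarrow> 'b \<Rightarrow> (real^'n) \<times> (real^'n)" where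
  "acd_update blk L g \<alpha> \<sigma> a A B k s i =
     (let y = acd_mix \<sigma> a A B k s in
       (y + (1 / L i) *\<^sub>R (- block_part blk i (g y)),
        (1 - \<sigma> * a (Suc k) / B (Suc k)) *\<^sub>R snd s + (\<sigma> * a (Suc k) / B (Suc k)) *\<^sub>R y
          + (a (Suc k) / (L i powr (1 - \<alpha>) * B (Suc k) * Lprob L (\<alpha> / 2) i))
              *\<^sub>R (- block_part blk i (g y))))"

text \<open>
The sample path as a Markov recursion on the pair \<open>(x, \<nu>)\<close>, the state to which the potential refers.
\<close>

lemma acd_path_update:
  assumes "acd_path blk L g \<alpha> \<sigma> a A B x0 I x y \<nu>"
  shows "x 0 = x0" "\<nu> 0 = x0"
    and "(x (Suc k), \<nu> (Suc k)) = acd_update blk L g \<alpha> \<sigma> a A B k (x k, \<nu> k) (I k)"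
proof -
  show "x 0 = x0" "\<nu> 0 = x0" using assms by (simp_all add: acd_path_def)
  have y: "y k = acd_mix \<sigma> a A B k (x k, \<nu> k)"
    using assms unfolding acd_path_def Let_def acd_mix_def fst_conv snd_conv by blast
  show "(x (Suc k), \<nu> (Suc k)) = acd_update blk L g \<alpha> \<sigma> a A B k (x k, \<nu> k) (I k)"
    using assms unfolding acd_path_def Let_def acd_update_def snd_conv y[symmetric] prod.inject
    by blast
qed

text \<open>
Iterating the decrease of the potential bounds \<open>2 * A k * (E (f (x k)) - f z)\<close> by the initial
potential \<open>Q (x0 - z)\<close>, since \<open>A 0 = 0\<close> and \<open>B 0 = 1\<close>; the quadratic growth of \<open>A\<close> gives the rate.
\<close>

lemma acd_expected_gap:
  fixes f :: "real^'n \<Rightarrow> real" and blk :: "'n \<Rightarrow> 'b::finite" and L :: "'b \<Rightarrow> real"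
    and x y \<nu> :: "nat \<Rightarrow> 'w \<Rightarrow> real^'n"
  assumes M: "prob_space M" and sampling: "acd_sampling M L \<alpha> I"
    and scalars: "acd_scalars L \<alpha> \<sigma> a A B"
    and path: "\<And>w. w \<in> space M \<Longrightarrow> acd_path blk L g \<alpha> \<sigma> a A B x0
                 (\<lambda>j. I j w) (\<lambda>j. x j w) (\<lambda>j. y j w) (\<lambda>j. \<nu> j w)"
    and L: "\<And>i. 0 < L i"
    and descent: "\<And>i y. f (y - (1 / L i) *\<^sub>R block_part blk i (g y))
        \<le> f y - (norm (block_part blk i (g y)))\<^sup>2 / (2 * L i)"
    and sc: "strongly_convex f g (wnorm blk (\<lambda>_. norm) L (1 - \<alpha>)) \<sigma>"
    and k: "1 \<le> k"
  shows "integrable M (\<lambda>w. f (x k w))"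
    and "(\<integral>w. f (x k w) \<partial>M) - f z
      \<le> 2 * (Lsum L (\<alpha> / 2))\<^sup>2 * (wnorm blk (\<lambda>_. norm) L (1 - \<alpha>) (x0 - z))\<^sup>2 / (real k)\<^sup>2"
proof -
  interpret prob_space M by (rule M)
  define Q where "Q v = (wnorm blk (\<lambda>_. norm) L (1 - \<alpha>) v)\<^sup>2" for v
  define \<Phi> where "\<Phi> k s = 2 * A k * (f (fst s) - f z) + B k * Q (snd s - z)" for k s
  let ?step = "acd_update blk L g \<alpha> \<sigma> a A B"
  have \<sigma>: "0 \<le> \<sigma>" using sc by (simp add: strongly_convex_def)
  have indep: "indep_vars (\<lambda>_. count_space UNIV) I UNIV"
    and p: "\<And>k i. prob {w \<in> space M. I k w = i} = Lprob L (\<alpha> / 2) i"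
    using sampling by (auto simp: acd_sampling_def)
  have AB: "0 < a (Suc k)" "A (Suc k) = A k + a (Suc k)" "B (Suc k) = B k + \<sigma> * a (Suc k)"
    "(a (Suc k))\<^sup>2 * (Lsum L (\<alpha> / 2))\<^sup>2 = A (Suc k) * B (Suc k)" for k
    using scalars unfolding acd_scalars_def by blast+
  note A_nonneg = acd_scalars_bounds(1)[OF scalars \<sigma>] and B_ge_1 = acd_scalars_bounds(2)[OF scalars \<sigma>]
  have B_pos: "0 < B k" for k using B_ge_1[of k] by linarith
  have decrease: "(\<Sum>i\<in>UNIV. Lprob L (\<alpha> / 2) i * \<Phi> (Suc k) (?step k s i)) \<le> \<Phi> k s" for k s
    unfolding \<Phi>_def Q_def
    by (rule acd_step_potential[OF L descent sc AB(1)[of k] A_nonneg B_pos AB(2-4)[of k]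
          acd_mix_def[of \<sigma> a A B k s]])
       (simp_all add: acd_update_def Let_def)
  have init: "(x 0 w, \<nu> 0 w) = (x0, x0)" if "w \<in> space M" for w
    using acd_path_update(1,2)[OF path[OF that]] by simp
  have step: "(x (Suc k) w, \<nu> (Suc k) w) = ?step k (x k w, \<nu> k w) (I k w)" if "w \<in> space M" for k w
    by (rule acd_path_update(3)[OF path[OF that]])
  note potential = expectation_potential_le[where s = "\<lambda>k w. (x k w, \<nu> k w)" and \<Phi> = \<Phi>,
      OF indep p init step decrease]
  show int: "integrable M (\<lambda>w. f (x k w))"
    using potential(1)[where h = "\<lambda>s. f (fst s)"] by simp
  have "2 * A k * (expectation (\<lambda>w. f (x k w)) - f z)
      = expectation (\<lambda>w. 2 * A k * (f (x k w) - f z))"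
    using int by (simp add: prob_space)
  also have "\<dots> \<le> expectation (\<lambda>w. \<Phi> k (x k w, \<nu> k w))"
    using int potential(1)[where h = "\<Phi> k"] B_ge_1[of k]
    by (intro integral_mono) (auto simp: \<Phi>_def Q_def)
  also have "\<dots> \<le> \<Phi> 0 (x0, x0)" by (rule potential(2))
  also have "\<dots> = Q (x0 - z)" using scalars by (simp add: \<Phi>_def acd_scalars_def)
  finally have gap: "2 * A k * (expectation (\<lambda>w. f (x k w)) - f z) \<le> Q (x0 - z)" .
  have "(real k)\<^sup>2 * (expectation (\<lambda>w. f (x k w)) - f z) \<le> 2 * (Lsum L (\<alpha> / 2))\<^sup>2 * Q (x0 - z)"
    \<comment> \<open>The comparison point \<open>z\<close> is arbitrary, so the gap may be negative.\<close>
  proof (cases "0 \<le> expectation (\<lambda>w. f (x k w)) - f z")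
    case True
    have "(real k)\<^sup>2 * (expectation (\<lambda>w. f (x k w)) - f z)
        \<le> 4 * (Lsum L (\<alpha> / 2))\<^sup>2 * A k * (expectation (\<lambda>w. f (x k w)) - f z)"
      by (rule mult_right_mono[OF acd_scalars_growth[OF scalars \<sigma> L] True])
    also have "\<dots> = 2 * (Lsum L (\<alpha> / 2))\<^sup>2 * (2 * A k * (expectation (\<lambda>w. f (x k w)) - f z))"
      by simp
    also have "\<dots> \<le> 2 * (Lsum L (\<alpha> / 2))\<^sup>2 * Q (x0 - z)"
      by (rule mult_left_mono[OF gap]) simp
    finally show ?thesis .
  next
    case False
    then have "(real k)\<^sup>2 * (expectation (\<lambda>w. f (x k w)) - f z) \<le> 0"
      by (intro mult_nonneg_nonpos) simp_all
    also have "0 \<le> 2 * (Lsum L (\<alpha> / 2))\<^sup>2 * Q (x0 - z)" by (simp add: Q_def)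
    finally show ?thesis .
  qed
  then show "expectation (\<lambda>w. f (x k w)) - f z
      \<le> 2 * (Lsum L (\<alpha> / 2))\<^sup>2 * (wnorm blk (\<lambda>_. norm) L (1 - \<alpha>) (x0 - z))\<^sup>2 / (real k)\<^sup>2"
    using k by (simp add: Q_def pos_le_divide_eq mult.commute)
qed

theorem theorem6:
  fixes F :: "real^'n \<Rightarrow> ereal" and Fstar \<gamma> D \<alpha> \<sigma> :: real
    and Fg :: "real^'n \<Rightarrow> real" and g Bop Cop :: "real^'n \<Rightarrow> real^'n"
    and blk :: "'n \<Rightarrow> 'b::finite" and nrm :: "'b \<Rightarrow> real^'n \<Rightarrow> real" and L :: "'b \<Rightarrow> real"
    and x0 xstar :: "real^'n"
    and M :: "'w measure" and I :: "nat \<Rightarrow> 'w \<Rightarrow> 'b"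
    and a A B :: "nat \<Rightarrow> real" and x y \<nu> :: "nat \<Rightarrow> 'w \<Rightarrow> real^'n"
    and k :: nat
  assumes F: "proper_closed_convex F"
    and Fstar: "\<exists>z. F z = ereal Fstar" "\<forall>z. ereal Fstar \<le> F z"
    and \<gamma>: "0 < \<gamma>"
    and nrm: "\<forall>i. is_norm_on (block_space blk i) (nrm i)"
    and nrm_ge: "\<forall>i. \<forall>h\<in>block_space blk i. norm h \<le> nrm i h"
    and smoothing: "smoothing_assumption F Fstar Fg g Bop Cop \<gamma> D blk nrm L"
    and xstar: "\<forall>z. Fg xstar \<le> Fg z"
    and \<sigma>: "strongly_convex Fg g (wnorm blk nrm L (1 - \<alpha>)) \<sigma>"
    and M: "prob_space M"
    and sampling: "acd_sampling M L \<alpha> I"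
    and scalars: "acd_scalars L \<alpha> \<sigma> a A B"
    and path: "\<forall>w\<in>space M. acd_path blk L g \<alpha> \<sigma> a A B x0
                 (\<lambda>j. I j w) (\<lambda>j. x j w) (\<lambda>j. y j w) (\<lambda>j. \<nu> j w)"
    and k: "1 \<le> k"
    and bounds_at_iterate: "AE w in M. smoothing_bounds F Fg Bop Cop \<gamma> D (x k w)"
  shows "ereal_expectation M (\<lambda>w. F (Bop (x k w))) - ereal Fstar
     \<le> ereal (2 * (Lsum L (\<alpha> / 2))\<^sup>2 * (wnorm blk nrm L (1 - \<alpha>) (x0 - xstar))\<^sup>2 / (real k)\<^sup>2 + \<gamma> * D)"
proof -
  interpret prob_space M by (rule M)
  let ?E = "wnorm blk (\<lambda>_. norm) L (1 - \<alpha>)" and ?W = "wnorm blk nrm L (1 - \<alpha>)"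
  define S where "S = Lsum L (\<alpha> / 2)"
  have grad: "\<And>x. GDERIV Fg x :> g x" and lip: "block_lipschitz blk nrm L g"
    and D: "\<exists>z. (\<forall>y. Fg z \<le> Fg y) \<and> Fg z \<le> Fstar"
    using smoothing unfolding smoothing_assumption_def by blast+
  have Fg_min: "Fg xstar \<le> Fstar" using D xstar order_trans by blast
  have L: "\<And>i. 0 < L i" using lip by (simp add: block_lipschitz_def)
  have le_W: "(?E v)\<^sup>2 \<le> (?W v)\<^sup>2" for v
    using nrm_ge by (intro wnorm_euclidean_le) blast
  have \<sigma>0: "0 \<le> \<sigma>" and scW: "\<And>x y. Fg x + g x \<bullet> (y - x) + \<sigma> / 2 * (?W (y - x))\<^sup>2 \<le> Fg y"
    using \<sigma> unfolding strongly_convex_def by blast+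
  \<comment> \<open>The Euclidean norm is the smaller one: strong convexity passes to it, and the final distance
    passes back.\<close>
  have scE: "Fg x + g x \<bullet> (y - x) + \<sigma> / 2 * (?E (y - x))\<^sup>2 \<le> Fg y" for x y
    using scW[of x y] mult_left_mono[OF le_W[of "y - x"], of "\<sigma> / 2"] \<sigma>0 by linarith
  have cvx: "Fg x + g x \<bullet> (y - x) \<le> Fg y" for x y
  proof -
    have "0 \<le> \<sigma> / 2 * (?W (y - x))\<^sup>2" using \<sigma>0 by simp
    then show ?thesis using scW[of x y] by linarith
  qed
  have descent: "Fg (y - (1 / L i) *\<^sub>R block_part blk i (g y))
      \<le> Fg y - (norm (block_part blk i (g y)))\<^sup>2 / (2 * L i)" for i y
    using nrm nrm_ge by (intro block_gradient_step[OF grad cvx _ _ lip]) blast+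
  have sc: "strongly_convex Fg g ?E \<sigma>"
    unfolding strongly_convex_def using \<sigma>0 scE by blast
  have path': "acd_path blk L g \<alpha> \<sigma> a A B x0 (\<lambda>j. I j w) (\<lambda>j. x j w) (\<lambda>j. y j w) (\<lambda>j. \<nu> j w)"
    if "w \<in> space M" for w using path that by blast
  note gap = acd_expected_gap[OF M sampling scalars path' L descent sc k]
  have int: "integrable M (\<lambda>w. Fg (x k w) + \<gamma> * D)" using gap(1) by simp
  have "F (Bop (x k w)) \<le> ereal (Fg (x k w) + \<gamma> * D)"
    if "smoothing_bounds F Fg Bop Cop \<gamma> D (x k w)" for w
    using that unfolding smoothing_bounds_def by (cases "F (Bop (x k w))") auto
  then have "AE w in M. F (Bop (x k w)) \<le> ereal (Fg (x k w) + \<gamma> * D)"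
    using bounds_at_iterate by (auto elim: eventually_mono)
  then have "ereal_expectation M (\<lambda>w. F (Bop (x k w)))
      \<le> ereal (expectation (\<lambda>w. Fg (x k w) + \<gamma> * D))"
    by (rule ereal_expectation_le_integral[OF int])
  also have "expectation (\<lambda>w. Fg (x k w) + \<gamma> * D) = expectation (\<lambda>w. Fg (x k w)) + \<gamma> * D"
    using gap(1) by (simp add: prob_space)
  finally have "ereal_expectation M (\<lambda>w. F (Bop (x k w))) - ereal Fstar
      \<le> ereal (expectation (\<lambda>w. Fg (x k w)) + \<gamma> * D) - ereal Fstar"
    by (rule ereal_minus_mono) simp
  also have "\<dots> = ereal (expectation (\<lambda>w. Fg (x k w)) + \<gamma> * D - Fstar)" by simp
  also have "\<dots> \<le> ereal (2 * S\<^sup>2 * (?W (x0 - xstar))\<^sup>2 / (real k)\<^sup>2 + \<gamma> * D)"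
  proof -
    have "expectation (\<lambda>w. Fg (x k w)) - Fg xstar \<le> 2 * S\<^sup>2 * (?E (x0 - xstar))\<^sup>2 / (real k)\<^sup>2"
      unfolding S_def by (rule gap(2))
    also have "\<dots> \<le> 2 * S\<^sup>2 * (?W (x0 - xstar))\<^sup>2 / (real k)\<^sup>2"
      by (intro divide_right_mono mult_left_mono le_W) simp_all
    finally show ?thesis using Fg_min by simp
  qed
  finally show ?thesis unfolding S_def .
qed

end
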